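(* Let $Q$ be a rack, $Y$ a $Q$-set, $A$ an abelian group, and $\theta:C_2^{\mathrm R}(Q)_Y\to A$ a shadow rack 2-cocycle. Let $m,n\in\mathbb{Z}_{>0}$ be arbitrary and fix $e_1,\ldots,e_m\in\{-1,1\}$ and $i_1,\ldots,i_m\in\{1,\ldots,n\}$. (1) The Cartesian product $Q^n$ is a rack with the binary operation $$(a_1,\ldots,a_n)*(b_1,\ldots,b_n)=(a_1*^{e_1}b_{i_1}*^{e_2}\cdots*^{e_m}b_{i_m},\ \ldots,\ a_n*^{e_1}b_{i_1}*^{e_2}\cdots*^{e_m}b_{i_m}).$$ Moreover, $Y$ is a $Q^n$-set with the map $\star$ defined by $\upsilon\star(a_1,\ldots,a_n)=\upsilon\star^{e_1}a_{i_1}\star^{e_2}\cdots\star^{e_m}a_{i_m}$. (2) Let $Q^n$ be the rack and $Y$ the $Q^n$-set of (1). Define a 2-cochain $\overline\theta:C_2^{\mathrm R}(Q^n)_Y\to A$ by $$\overline\theta\big(\langle\upsilon\rangle\langle(a_1,\ldots,a_n)\rangle\langle(b_1,\ldots,b_n)\rangle\big)=\sum_{p=1}^m\sum_{q=1}^m e_pe_q\,\theta\big(\langle\upsilon_{p,q}\rangle\langle a_{p,q}\rangle\langle b_{i_q}\rangle\big),$$ where $$\upsilon_{p,q}=\upsilon\star^{e_1}a_{i_1}\star^{e_2}\cdots\star^{e_{p-1}}a_{i_{p-1}}\star^{-\delta(e_p,-1)}a_{i_p}\star^{e_1}b_{i_1}\star^{e_2}\cdots\star^{e_{q-1}}b_{i_{q-1}}\star^{-\delta(e_q,-1)}b_{i_q},$$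 $$a_{p,q}=a_{i_p}*^{e_1}b_{i_1}*^{e_2}\cdots*^{e_{q-1}}b_{i_{q-1}}*^{-\delta(e_q,-1)}b_{i_q},$$ and $\delta$ is the Kronecker delta. Then $\overline\theta$ is a shadow rack 2-cocycle.
   Context: A rack is a non-empty set $Q$ with a binary operation $*$ such that $S_a:Q\to Q$, $S_a(x)=x*a$, is bijective for every $a\in Q$ and $(a*b)*c=(a*c)*(b*c)$ for all $a,b,c\in Q$. A $Q$-set is a non-empty set $Y$ with a map $\star:Y\times Q\to Y$ such that $T_a:Y\to Y$, $T_a(\upsilon)=\upsilon\star a$, is bijective for every $a\in Q$ and $(\upsilon\star a)\star b=(\upsilon\star b)\star(a*b)$ for all $\upsilon\in Y$, $a,b\in Q$. For $i\in\mathbb{Z}$ write $b*^ia=S_a^i(b)$ and $\upsilon\star^ia=T_a^i(\upsilon)$ (with $S_a^0$, $T_a^0$ identities); iterated expressions without parentheses are read from left to right. $C_2^{\mathrm R}(Q)_Y=\mathbb{Z}[Y\times Q^2]$ is the free abelian group on the symbols $\langle\upsilon\rangle\langle a\rangle\langle b\rangle$ ($\upsilon\in Y$, $a,b\in Q$). A 2-cochain, i.e. a homomorphism $\theta:C_2^{\mathrm R}(Q)_Y\to A$, is a shadow rack 2-cocycle (of $(Q,Y)$) if for all $\upsilon\in Y$ and $a,b,c\in Q$: $$\theta(\langle\upsilon\star a\rangle\langle b\rangle\langle c\rangle+\langle\upsilon\rangle\langle a\rangle\langle c\rangle+\langle\upsilon\star c\rangle\langle a*c\rangle\langle b*c\rangle)=\theta(\langle\upsilon\rangle\langle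 b\rangle\langle c\rangle+\langle\upsilon\star b\rangle\langle a*b\rangle\langle c\rangle+\langle\upsilon\rangle\langle a\rangle\langle b\rangle).$$ *)

theory Defs
  imports "HOL-Algebra.Free_Abelian_Groups"
begin

text \<open>
  Racks and their sets are given by carrier sets, so that the power of a rack is again
  an object of the same kind, for an exponent that is an ordinary natural number.
  Operations are only constrained on the carriers.
\<close>

locale rack =
  fixes Q :: "'q set" and rop :: "'q \<Rightarrow> 'q \<Rightarrow> 'q" (infixl "\<^bold>*" 70)
  assumes rack_nonempty: "Q \<noteq> {}"
    and rack_bij: "a \<in> Q \<Longrightarrow> bij_betw (\<lambda>x. x \<^bold>* a) Q Q"
    and rack_distrib: "\<lbrakk>a \<in> Q; b \<in> Q; c \<in> Q\<rbrakk> \<Longrightarrow> (a \<^bold>* b) \<^bold>* c = (a \<^bold>* c) \<^bold>* (b \<^bold>* c)"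

locale rack_set = rack Q rop
  for Q :: "'q set" and rop :: "'q \<Rightarrow> 'q \<Rightarrow> 'q" (infixl "\<^bold>*" 70) +
  fixes Y :: "'y set" and act :: "'y \<Rightarrow> 'q \<Rightarrow> 'y" (infixl "\<star>" 70)
  assumes set_nonempty: "Y \<noteq> {}"
    and act_bij: "a \<in> Q \<Longrightarrow> bij_betw (\<lambda>y. y \<star> a) Y Y"
    and act_distrib: "\<lbrakk>y \<in> Y; a \<in> Q; b \<in> Q\<rbrakk> \<Longrightarrow> (y \<star> a) \<star> b = (y \<star> b) \<star> (a \<^bold>* b)"

text \<open>Integer iterates of a bijection of \<open>X\<close>; the inverse is taken relative to \<open>X\<close>.\<close>

definition int_iter :: "'x set \<Rightarrow> ('x \<Rightarrow> 'x) \<Rightarrow> int \<Rightarrow> 'x \<Rightarrow> 'x" where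
  "int_iter X f k = (if 0 \<le> k then f ^^ nat k else inv_into X f ^^ nat (- k))"

text \<open>
  With \<open>X = Q\<close> and \<open>f\<close> the rack operation, \<open>op_pow X f x k c\<close> is \<open>x *\<^sup>k c\<close>;
  with \<open>X = Y\<close> and \<open>f\<close> the action, it is \<open>x \<star>\<^sup>k c\<close>.
\<close>

definition op_pow :: "'x set \<Rightarrow> ('x \<Rightarrow> 'q \<Rightarrow> 'x) \<Rightarrow> 'x \<Rightarrow> int \<Rightarrow> 'q \<Rightarrow> 'x" where
  "op_pow X f x k c = int_iter X (\<lambda>z. f z c) k x"

text \<open>\<open>word_op X f e c r x\<close> is the left-to-right expression
  \<open>x *\<^bsup>e 1\<^esup> c 1 *\<^bsup>e 2\<^esup> \<dots> *\<^bsup>e r\<^esup> c r\<close>.\<close>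

definition word_op ::
  "'x set \<Rightarrow> ('x \<Rightarrow> 'q \<Rightarrow> 'x) \<Rightarrow> (nat \<Rightarrow> int) \<Rightarrow> (nat \<Rightarrow> 'q) \<Rightarrow> nat \<Rightarrow> 'x \<Rightarrow> 'x" where
  "word_op X f e c r x = foldl (\<lambda>z p. op_pow X f z (e p) (c p)) x [1..<Suc r]"

text \<open>\<open>partial_op X f e c p x\<close>, for \<open>p \<ge> 1\<close>, is
  \<open>x *\<^bsup>e 1\<^esup> c 1 *\<^bsup>e 2\<^esup> \<dots> *\<^bsup>e (p-1)\<^esup> c (p-1) *\<^bsup>-\<delta>(e p,-1)\<^esup> c p\<close>.\<close>

definition partial_op ::
  "'x set \<Rightarrow> ('x \<Rightarrow> 'q \<Rightarrow> 'x) \<Rightarrow> (nat \<Rightarrow> int) \<Rightarrow> (nat \<Rightarrow> 'q) \<Rightarrow> nat \<Rightarrow> 'x \<Rightarrow> 'x" where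
  "partial_op X f e c p x =
     op_pow X f (word_op X f e c (p - 1) x) (- of_bool (e p = -1)) (c p)"

text \<open>Abelian groups are written multiplicatively, so cochains are homomorphisms from the
  (additive) free abelian group on \<open>Y \<times> Q \<times> Q\<close> to \<open>A\<close>, sums in \<open>A\<close>
  become products, and integer multiples become powers.\<close>

definition rack_2_chains :: "'q set \<Rightarrow> 'y set \<Rightarrow> ('y \<times> 'q \<times> 'q \<Rightarrow>\<^sub>0 int) monoid" where
  "rack_2_chains Q Y = free_Abelian_group (Y \<times> Q \<times> Q)"

definition shadow_rack_2_cocycle ::
  "'q set \<Rightarrow> ('q \<Rightarrow> 'q \<Rightarrow> 'q) \<Rightarrow> 'y set \<Rightarrow> ('y \<Rightarrow> 'q \<Rightarrow> 'y) \<Rightarrow> ('a, 'z) monoid_scheme \<Rightarrow>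
   (('y \<times> 'q \<times> 'q \<Rightarrow>\<^sub>0 int) \<Rightarrow> 'a) \<Rightarrow> bool" where
  "shadow_rack_2_cocycle Q rop Y act A \<theta> \<longleftrightarrow>
     \<theta> \<in> hom (rack_2_chains Q Y) A \<and>
     (\<forall>y\<in>Y. \<forall>a\<in>Q. \<forall>b\<in>Q. \<forall>c\<in>Q.
        \<theta> (frag_of (act y a, b, c) + frag_of (y, a, c) + frag_of (act y c, rop a c, rop b c)) =
        \<theta> (frag_of (y, b, c) + frag_of (act y b, rop a b, c) + frag_of (y, a, b)))"

text \<open>Tuples in \<open>Q\<^sup>n\<close> are extensional functions on \<open>{1..n}\<close>.\<close>

definition rack_power :: "nat \<Rightarrow> 'q set \<Rightarrow> (nat \<Rightarrow> 'q) set" where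
  "rack_power n Q = {1..n} \<rightarrow>\<^sub>E Q"

definition power_op ::
  "'q set \<Rightarrow> ('q \<Rightarrow> 'q \<Rightarrow> 'q) \<Rightarrow> nat \<Rightarrow> nat \<Rightarrow> (nat \<Rightarrow> int) \<Rightarrow> (nat \<Rightarrow> nat) \<Rightarrow>
   (nat \<Rightarrow> 'q) \<Rightarrow> (nat \<Rightarrow> 'q) \<Rightarrow> (nat \<Rightarrow> 'q)" where
  "power_op Q rop n m e i a b = (\<lambda>k\<in>{1..n}. word_op Q rop e (\<lambda>p. b (i p)) m (a k))"

definition power_act ::
  "'y set \<Rightarrow> ('y \<Rightarrow> 'q \<Rightarrow> 'y) \<Rightarrow> nat \<Rightarrow> (nat \<Rightarrow> int) \<Rightarrow> (nat \<Rightarrow> nat) \<Rightarrow>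
   'y \<Rightarrow> (nat \<Rightarrow> 'q) \<Rightarrow> 'y" where
  "power_act Y act m e i y a = word_op Y act e (\<lambda>p. a (i p)) m y"

text \<open>The value prescribed for the induced cochain on the generator \<open>(y, a, b)\<close>.\<close>

definition induced_value ::
  "'q set \<Rightarrow> ('q \<Rightarrow> 'q \<Rightarrow> 'q) \<Rightarrow> 'y set \<Rightarrow> ('y \<Rightarrow> 'q \<Rightarrow> 'y) \<Rightarrow> ('a, 'z) monoid_scheme \<Rightarrow>
   (('y \<times> 'q \<times> 'q \<Rightarrow>\<^sub>0 int) \<Rightarrow> 'a) \<Rightarrow> nat \<Rightarrow> (nat \<Rightarrow> int) \<Rightarrow> (nat \<Rightarrow> nat) \<Rightarrow>
   'y \<Rightarrow> (nat \<Rightarrow> 'q) \<Rightarrow> (nat \<Rightarrow> 'q) \<Rightarrow> 'a" where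
  "induced_value Q rop Y act A \<theta> m e i y a b =
     (\<Otimes>\<^bsub>A\<^esub>p\<in>{1..m}. \<Otimes>\<^bsub>A\<^esub>q\<in>{1..m}.
        \<theta> (frag_of
             (partial_op Y act e (\<lambda>r. b (i r)) q (partial_op Y act e (\<lambda>r. a (i r)) p y),
              partial_op Q rop e (\<lambda>r. b (i r)) q (a (i p)),
              b (i q)))
        [^]\<^bsub>A\<^esub> (e p * e q))"

end

theory Submission
  imports Defs
begin

text \<open>
  Acting by \<open>b = (b\<^sub>1, \<dots>, b\<^sub>n)\<close> in \<open>Q\<^sup>n\<close> means acting
  successively by the letters of the word \<open>b\<^bsub>i 1\<^esub>\<^bsup>e 1\<^esup> \<dots> b\<^bsub>i m\<^esub>\<^bsup>e m\<^esup>\<close>,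
  and the tuple \<open>a * b\<close> spells the word obtained from that of \<open>a\<close> by letting the word of
  \<open>b\<close> act on each letter. So it suffices to pass from \<open>Q\<close> to signed letters and from
  there to words.

  Signed letters. The set \<open>Q \<times> {-1, 1}\<close> is a rack in which \<open>(b, -1)\<close> acts by the
  inverse of \<open>b\<close> and signs of letters acted upon are kept, and it acts on every \<open>Q\<close>-set
  (\<open>rack_signed\<close>, \<open>rack_set_signed\<close>). Words over a rack act on its sets by
  successive letters, and self-distributivity survives (\<open>foldl_act_distrib\<close>). Since
  \<open>Q\<close> is itself a \<open>Q\<close>-set, these facts give both halves of the rack and
  \<open>Q\<^sup>n\<close>-set assertions.

  Cochains. Geometrically, \<open>\<psi> y a b\<close> is the weight of a crossing of strands coloured
  \<open>a\<close> and \<open>b\<close> next to a region coloured \<open>y\<close>. A negative letter is a strand with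
  reversed orientation: its crossings get the opposite sign, and the colours are read on its other side,
  which is why the exponents \<open>-\<delta>(e p, -1)\<close> appear. A word is a bundle of parallel strands, and
  two bundles cross in a grid of crossings, whose total weight is the double sum of the statement.
  The cocycle condition is the third Reidemeister move. It is convenient to consider the defect, that
  is, the difference of its two sides, for cochains with values in an abelian group and to ask that
  the defect lie in a given subgroup \<open>K\<close>. The defect at a negative letter is minus the defect at
  the corresponding positive letter, taken on the other side of the strand
  (\<open>signed_defect_invert_first\<close> and its companions), and the defect at concatenated words is the sum of the defects at the factors
  (\<open>word_defect_append_first\<close> and its companions), corresponding to moving one bundle of strands
  past a crossing one strand at a time. Hence the condition modulo \<open>K\<close> passes from \<open>Q\<close> to
  signed letters, to words, and so to tuples.

  To apply this, let \<open>\<psi>\<close> be the universal cochain, which sends a triple to the generator it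
  names in the free abelian group, and \<open>K\<close> the kernel of \<open>\<theta>\<close>: then \<open>\<theta>\<close> is a
  cocycle precisely when the defect of \<open>\<psi>\<close> lies in \<open>K\<close>. This keeps the computation in
  additive notation, and \<open>\<theta>\<close> is applied only at the end, where it turns the chain attached to
  two tuples into the prescribed value (\<open>induced_value_eq\<close>).
\<close>

section \<open>Signed letters\<close>

lemma op_pow_simps [simp]:
  "op_pow X f x 1 c = f x c"
  "op_pow X f x 0 c = x"
  "op_pow X f x (-1) c = inv_into X (\<lambda>z. f z c) x"
  by (simp_all add: op_pow_def int_iter_def)

text \<open>
  By this lemma everything proved about the action on a set \<open>Y\<close> also describes the operation of
  the rack on its own elements.
\<close>

lemma (in rack) rack_set_self: "rack_set Q rop Q rop"
  by unfold_locales (use rack_nonempty rack_bij rack_distrib in auto)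

definition signed_letters :: "'q set \<Rightarrow> ('q \<times> int) set" where
  "signed_letters Q = Q \<times> {-1, 1}"

definition signed_act :: "'y set \<Rightarrow> ('y \<Rightarrow> 'q \<Rightarrow> 'y) \<Rightarrow> 'y \<Rightarrow> 'q \<times> int \<Rightarrow> 'y" where
  "signed_act Y act y x = op_pow Y act y (snd x) (fst x)"

definition signed_rop :: "'q set \<Rightarrow> ('q \<Rightarrow> 'q \<Rightarrow> 'q) \<Rightarrow> 'q \<times> int \<Rightarrow> 'q \<times> int \<Rightarrow> 'q \<times> int" where
  "signed_rop Q rop x z = (signed_act Q rop (fst x) z, snd x)"

context rack_set
begin

lemma act_closed: "y \<in> Y \<Longrightarrow> a \<in> Q \<Longrightarrow> y \<star> a \<in> Y"
  using act_bij bij_betwE by fastforce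

abbreviation undo :: "'y \<Rightarrow> 'q \<Rightarrow> 'y" where
  "undo y a \<equiv> inv_into Y (\<lambda>z. z \<star> a) y"

lemma undo_closed: "y \<in> Y \<Longrightarrow> a \<in> Q \<Longrightarrow> undo y a \<in> Y"
  by (metis act_bij bij_betw_def inv_into_into)

lemma undo_act: "y \<in> Y \<Longrightarrow> a \<in> Q \<Longrightarrow> undo y a \<star> a = y"
  using bij_betw_inv_into_right[OF act_bij] by simp

lemma act_undo: "y \<in> Y \<Longrightarrow> a \<in> Q \<Longrightarrow> undo (y \<star> a) a = y"
  using bij_betw_inv_into_left[OF act_bij] by simp

lemma signed_act_closed:
  "y \<in> Y \<Longrightarrow> x \<in> signed_letters Q \<Longrightarrow> signed_act Y act y x \<in> Y"
  by (auto simp: signed_letters_def signed_act_def act_closed undo_closed)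

lemma signed_act_bij:
  assumes "x \<in> signed_letters Q"
  shows "bij_betw (\<lambda>y. signed_act Y act y x) Y Y"
  using assms act_bij bij_betw_inv_into[OF act_bij]
  by (auto simp: signed_letters_def signed_act_def)

text \<open>
  The action of \<open>b\<close> carries the action of \<open>a\<close> to that of \<open>a * b\<close>, hence also
  the inverse of the former to the inverse of the latter; this settles positive \<open>z\<close>. The case
  of a negative \<open>z\<close> is the positive one read backwards, at the preimages of \<open>y\<close> and
  \<open>a\<close>.
\<close>

lemma signed_act_distrib:
  assumes y: "y \<in> Y" and x: "x \<in> signed_letters Q" and z: "z \<in> signed_letters Q"
  shows "signed_act Y act (signed_act Y act y x) z =
    signed_act Y act (signed_act Y act y z) (signed_rop Q rop x z)"
proof -
  interpret self: rack_set Q rop Q rop by (rule rack_set_self)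
  have pos: "signed_act Y act y (a, k) \<star> b = signed_act Y act (y \<star> b) (a \<^bold>* b, k)"
    if "y \<in> Y" "a \<in> Q" "b \<in> Q" "k \<in> {-1, 1}" for y a b k
  proof (cases "k = 1")
    case True
    then show ?thesis using that by (simp add: signed_act_def act_distrib)
  next
    case False
    let ?u = "undo y a"
    have "(?u \<star> b) \<star> (a \<^bold>* b) = y \<star> b"
      using that by (metis act_distrib undo_act undo_closed)
    then have "undo (y \<star> b) (a \<^bold>* b) = ?u \<star> b"
      using that by (metis act_closed act_undo self.act_closed undo_closed)
    then show ?thesis using False that by (simp add: signed_act_def)
  qed
  obtain a k b l where ab: "x = (a, k)" "z = (b, l)" "a \<in> Q" "b \<in> Q" "k \<in> {-1, 1}" "l \<in> {-1, 1}"
    using x z by (auto simp: signed_letters_def)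
  show ?thesis
  proof (cases "l = 1")
    case True
    then show ?thesis using pos[OF y] ab by (simp add: signed_rop_def signed_act_def)
  next
    case False
    let ?y = "undo y b" and ?a = "self.undo a b"
    have c: "?y \<in> Y" "?a \<in> Q" using ab y by (simp_all add: undo_closed self.undo_closed)
    have "signed_act Y act ?y (?a, k) \<star> b = signed_act Y act y (a, k)"
      using pos[OF c] ab y by (simp add: undo_act self.undo_act)
    moreover have "signed_act Y act ?y (?a, k) \<in> Y"
      using c ab by (intro signed_act_closed) (auto simp: signed_letters_def)
    ultimately have "undo (signed_act Y act y (a, k)) b = signed_act Y act ?y (?a, k)"
      using ab act_undo by metis
    then show ?thesis using False ab by (simp add: signed_rop_def signed_act_def)
  qed
qed

end

lemma (in rack) rack_signed: "rack (signed_letters Q) (signed_rop Q rop)"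
proof -
  interpret self: rack_set Q rop Q rop by (rule rack_set_self)
  show ?thesis
  proof
    show "signed_letters Q \<noteq> {}" using rack_nonempty by (auto simp: signed_letters_def)
  next
    fix z assume "z \<in> signed_letters Q"
    then have "bij_betw (\<lambda>a. signed_act Q rop a z) Q Q" by (rule self.signed_act_bij)
    then have "bij_betw (map_prod (\<lambda>a. signed_act Q rop a z) id) (Q \<times> {-1, 1}) (Q \<times> {-1, 1})"
      by (rule bij_betw_map_prod) simp
    then show "bij_betw (\<lambda>x. signed_rop Q rop x z) (signed_letters Q) (signed_letters Q)"
      by (simp add: signed_letters_def signed_rop_def map_prod_def case_prod_unfold)
  next
    fix x y z assume "x \<in> signed_letters Q" "y \<in> signed_letters Q" "z \<in> signed_letters Q"
    then show "signed_rop Q rop (signed_rop Q rop x y) z =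
        signed_rop Q rop (signed_rop Q rop x z) (signed_rop Q rop y z)"
      using self.signed_act_distrib[of "fst x" y z] 
      by (auto simp: signed_rop_def signed_letters_def)
  qed
qed

lemma (in rack_set) rack_set_signed:
  "rack_set (signed_letters Q) (signed_rop Q rop) Y (signed_act Y act)"
proof -
  interpret signed: rack "signed_letters Q" "signed_rop Q rop" by (rule rack_signed)
  show ?thesis
    by unfold_locales (use set_nonempty signed_act_bij signed_act_distrib in auto)
qed

section \<open>Words\<close>

definition word_rop :: "('q \<Rightarrow> 'q \<Rightarrow> 'q) \<Rightarrow> 'q list \<Rightarrow> 'q list \<Rightarrow> 'q list" where
  "word_rop rop v w = map (\<lambda>a. foldl rop a w) v"

lemma word_rop_simps [simp]:
  "word_rop rop [] w = []"
  "word_rop rop (a # v) w = foldl rop a w # word_rop rop v w"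
  "word_rop rop v [] = v"
  by (simp_all add: word_rop_def)

lemma word_rop_append:
  "word_rop rop (u @ v) w = word_rop rop u w @ word_rop rop v w"
  "word_rop rop u (v @ w) = word_rop rop (word_rop rop u v) w"
  by (simp_all add: word_rop_def)

context rack_set
begin

lemma foldl_act_closed: "y \<in> Y \<Longrightarrow> w \<in> lists Q \<Longrightarrow> foldl act y w \<in> Y"
  by (induction w arbitrary: y) (auto simp: act_closed)

lemma foldl_act_bij:
  assumes "w \<in> lists Q"
  shows "bij_betw (\<lambda>y. foldl act y w) Y Y"
  using assms
proof (induction w)
  case Nil
  then show ?case by (simp add: bij_betw_def)
next
  case (Cons a w)
  then show ?case using bij_betw_trans[OF act_bij[of a] Cons.IH] by (simp add: comp_def)
qed

text \<open>
  A word acts by a composite of the automorphisms given by its letters, so it is again compatible with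
  the action of a letter.
\<close>

lemma foldl_act_distrib_letter:
  assumes "y \<in> Y" "a \<in> Q" "w \<in> lists Q"
  shows "foldl act (y \<star> a) w = foldl act y w \<star> foldl rop a w"
proof -
  interpret self: rack_set Q rop Q rop by (rule rack_set_self)
  show ?thesis using assms
  proof (induction w arbitrary: y a)
    case (Cons b w)
    then have "foldl act (y \<star> a) (b # w) = foldl act ((y \<star> b) \<star> (a \<^bold>* b)) w"
      by (simp add: act_distrib[of y a b])
    then show ?case
      using Cons by (simp add: act_closed self.act_closed)
  qed simp
qed

lemma foldl_act_distrib:
  assumes "y \<in> Y" "v \<in> lists Q" "w \<in> lists Q"
  shows "foldl act (foldl act y v) w = foldl act (foldl act y w) (word_rop rop v w)"
  using assms
  by (induction v arbitrary: y) (auto simp: act_closed foldl_act_distrib_letter[of _ _ w])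

end

lemma (in rack) word_rop_closed: "v \<in> lists Q \<Longrightarrow> w \<in> lists Q \<Longrightarrow> word_rop rop v w \<in> lists Q"
proof -
  interpret self: rack_set Q rop Q rop by (rule rack_set_self)
  show "v \<in> lists Q \<Longrightarrow> w \<in> lists Q \<Longrightarrow> word_rop rop v w \<in> lists Q"
    by (induction v) (auto simp: self.foldl_act_closed)
qed

lemma (in rack) word_rop_distrib:
  assumes "u \<in> lists Q" "v \<in> lists Q" "w \<in> lists Q"
  shows "word_rop rop (word_rop rop u v) w =
    word_rop rop (word_rop rop u w) (word_rop rop v w)"
proof -
  interpret self: rack_set Q rop Q rop by (rule rack_set_self)
  show ?thesis using assms by (induction u) (auto simp: self.foldl_act_distrib[of _ v w])
qed

section \<open>Cochains on words\<close>

text \<open>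
  The three terms on either side are the three crossings before and after a third Reidemeister move.
\<close>

definition cocycle_defect where
  "cocycle_defect rop act \<psi> y a b c =
     \<psi> (act y a) b c + \<psi> y a c + \<psi> (act y c) (rop a c) (rop b c)
     - (\<psi> y b c + \<psi> (act y b) (rop a b) c + \<psi> y a b)"

definition cocycle_mod ::
  "('g::ab_group_add) set \<Rightarrow> 'q set \<Rightarrow> ('q \<Rightarrow> 'q \<Rightarrow> 'q) \<Rightarrow> 'y set \<Rightarrow> ('y \<Rightarrow> 'q \<Rightarrow> 'y) \<Rightarrow>
   ('y \<Rightarrow> 'q \<Rightarrow> 'q \<Rightarrow> 'g) \<Rightarrow> bool" where
  "cocycle_mod K Q rop Y act \<psi> \<longleftrightarrow>
     (\<forall>y\<in>Y. \<forall>a\<in>Q. \<forall>b\<in>Q. \<forall>c\<in>Q. cocycle_defect rop act \<psi> y a b c \<in> K)"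

text \<open>
  These are exactly the subgroups of the additive group of the type.
\<close>

locale difference_closed =
  fixes K :: "('g::ab_group_add) set"
  assumes zero_mem: "0 \<in> K" and diff_mem: "u \<in> K \<Longrightarrow> v \<in> K \<Longrightarrow> u - v \<in> K"
begin

lemma minus_mem: "u \<in> K \<Longrightarrow> - u \<in> K"
  using diff_mem[OF zero_mem] by fastforce

lemma add_mem: "u \<in> K \<Longrightarrow> v \<in> K \<Longrightarrow> u + v \<in> K"
  using diff_mem minus_mem by fastforce

end

text \<open>
  The total weight of a strand \<open>a\<close> crossing a bundle of parallel strands, and then of two
  bundles crossing each other. At each crossing both colours are updated by the strands already passed.
\<close>

fun letter_chain ::
  "('q \<Rightarrow> 'q \<Rightarrow> 'q) \<Rightarrow> ('y \<Rightarrow> 'q \<Rightarrow> 'y) \<Rightarrow> ('y \<Rightarrow> 'q \<Rightarrow> 'q \<Rightarrow> 'g::ab_group_add) \<Rightarrow>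
   'y \<Rightarrow> 'q \<Rightarrow> 'q list \<Rightarrow> 'g" where
  "letter_chain rop act \<psi> y a [] = 0"
| "letter_chain rop act \<psi> y a (b # w) =
     \<psi> y a b + letter_chain rop act \<psi> (act y b) (rop a b) w"

fun word_chain ::
  "('q \<Rightarrow> 'q \<Rightarrow> 'q) \<Rightarrow> ('y \<Rightarrow> 'q \<Rightarrow> 'y) \<Rightarrow> ('y \<Rightarrow> 'q \<Rightarrow> 'q \<Rightarrow> 'g::ab_group_add) \<Rightarrow>
   'y \<Rightarrow> 'q list \<Rightarrow> 'q list \<Rightarrow> 'g" where
  "word_chain rop act \<psi> y [] w = 0"
| "word_chain rop act \<psi> y (a # v) w =
     letter_chain rop act \<psi> y a w + word_chain rop act \<psi> (act y a) v w"

lemma letter_chain_append: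
  "letter_chain rop act \<psi> y a (v @ w) =
     letter_chain rop act \<psi> y a v + letter_chain rop act \<psi> (foldl act y v) (foldl rop a v) w"
  by (induction v arbitrary: y a) (auto simp: add.assoc)

lemma word_chain_append_left:
  "word_chain rop act \<psi> y (u @ v) w =
     word_chain rop act \<psi> y u w + word_chain rop act \<psi> (foldl act y u) v w"
  by (induction u arbitrary: y) (auto simp: add.assoc)

lemma word_chain_Nil_right [simp]: "word_chain rop act \<psi> y v [] = 0"
  by (induction v arbitrary: y) auto

text \<open>
  The recursion of \<open>word_chain\<close> is along its first word, so splitting the second word needs
  distributivity: after crossing \<open>v\<close>, the letters of \<open>u\<close> and the region next to each
  of them have all been acted upon by \<open>v\<close>, no matter in which order the two words act.
\<close>

lemma (in rack_set) word_chain_append_right: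
  assumes "y \<in> Y" "u \<in> lists Q" "v \<in> lists Q" "w \<in> lists Q"
  shows "word_chain rop act \<psi> y u (v @ w) =
    word_chain rop act \<psi> y u v +
    word_chain rop act \<psi> (foldl act y v) (word_rop rop u v) w"
  using assms
  by (induction u arbitrary: y)
    (auto simp: letter_chain_append act_closed foldl_act_distrib_letter[of _ _ v] algebra_simps)

context rack_set
begin

abbreviation word_defect where
  "word_defect \<psi> \<equiv> cocycle_defect (word_rop rop) (foldl act) (word_chain rop act \<psi>)"

text \<open>
  In each of the next three lemmas the four chains that have the split word as an argument break up
  additively. The remaining two have opposite signs and differ by the action of that word, so the
  chain reached after the action of its first factor cancels between the two summands.
\<close>

lemma word_defect_append_first:
  assumes "y \<in> Y" "u \<in> lists Q" "u' \<in> lists Q" "v \<in> lists Q" "w \<in> lists Q"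
  shows "word_defect \<psi> y (u @ u') v w = word_defect \<psi> y u v w + word_defect \<psi> (foldl act y u) u' v w"
  using assms
  by (simp add: cocycle_defect_def word_chain_append_left word_rop_append word_rop_closed
      foldl_act_closed foldl_act_distrib[of _ u v] foldl_act_distrib[of _ u w] algebra_simps
      del: in_lists_conv_set)

lemma word_defect_append_second:
  assumes "y \<in> Y" "u \<in> lists Q" "v \<in> lists Q" "v' \<in> lists Q" "w \<in> lists Q"
  shows "word_defect \<psi> y u (v @ v') w =
    word_defect \<psi> y u v w + word_defect \<psi> (foldl act y v) (word_rop rop u v) v' w"
  using assms
  by (simp add: cocycle_defect_def word_chain_append_left word_chain_append_right
      word_rop_append word_rop_closed word_rop_distrib[of u v w]
      foldl_act_closed foldl_act_distrib[of _ u v] foldl_act_distrib[of _ v w] algebra_simps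
      del: in_lists_conv_set)

lemma word_defect_append_third:
  assumes "y \<in> Y" "u \<in> lists Q" "v \<in> lists Q" "w \<in> lists Q" "w' \<in> lists Q"
  shows "word_defect \<psi> y u v (w @ w') =
    word_defect \<psi> y u v w +
    word_defect \<psi> (foldl act y w) (word_rop rop u w) (word_rop rop v w) w'"
  using assms
  by (simp add: cocycle_defect_def word_chain_append_right word_rop_append word_rop_closed
      foldl_act_closed foldl_act_distrib[of _ u w] foldl_act_distrib[of _ v w]
      word_rop_distrib[of u v w] algebra_simps
      del: in_lists_conv_set)

lemma word_defect_Nil:
  "word_defect \<psi> y [] v w = 0" "word_defect \<psi> y u [] w = 0" "word_defect \<psi> y u v [] = 0"
  by (simp_all add: cocycle_defect_def)

text \<open>
  Additivity of the defect in each of the three words reduces the claim to words of one letter, on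
  which \<open>word_chain\<close> is \<open>\<psi>\<close>.
\<close>

lemma cocycle_mod_words:
  assumes "difference_closed K" and coc: "cocycle_mod K Q rop Y act \<psi>"
  shows "cocycle_mod K (lists Q) (word_rop rop) Y (foldl act) (word_chain rop act \<psi>)"
proof -
  interpret difference_closed K by fact
  interpret self: rack_set Q rop Q rop by (rule rack_set_self)
  have 1: "word_defect \<psi> y [a] [b] [c] \<in> K" if "y \<in> Y" "a \<in> Q" "b \<in> Q" "c \<in> Q" for y a b c
    using coc that by (simp add: cocycle_mod_def cocycle_defect_def)
  have 2: "word_defect \<psi> y [a] [b] w \<in> K"
    if "y \<in> Y" "a \<in> Q" "b \<in> Q" "w \<in> lists Q" for y a b w
    using that(4,1-3)
  proof (induction w arbitrary: y a b)
    case (Cons c w)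
    then show ?case
      using word_defect_append_third[of y "[a]" "[b]" "[c]" w \<psi>]
      by (simp add: 1 add_mem act_closed self.act_closed)
  qed (simp add: word_defect_Nil zero_mem)
  have 3: "word_defect \<psi> y [a] v w \<in> K"
    if "y \<in> Y" "a \<in> Q" "v \<in> lists Q" "w \<in> lists Q" for y a v w
    using that(3,1,2,4)
  proof (induction v arbitrary: y a)
    case (Cons b v)
    then show ?case
      using word_defect_append_second[of y "[a]" "[b]" v w \<psi>]
      by (simp add: 2 add_mem act_closed self.act_closed)
  qed (simp add: word_defect_Nil zero_mem)
  have "word_defect \<psi> y u v w \<in> K"
    if "y \<in> Y" "u \<in> lists Q" "v \<in> lists Q" "w \<in> lists Q" for y u v w
    using that(2,1,3,4)
  proof (induction u arbitrary: y)
    case (Cons a u)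
    then show ?case
      using word_defect_append_first[of y "[a]" u v w \<psi>]
      by (simp add: 3 add_mem act_closed)
  qed (simp add: word_defect_Nil zero_mem)
  then show ?thesis by (simp add: cocycle_mod_def)
qed

end

section \<open>Signed cochains\<close>

text \<open>
  This acts only by negative letters. The region entering the weight of a crossing is the one before
  a positive letter but the one after a negative letter, so that the two differ exactly by a reversal
  of the strand.
\<close>

definition half_act :: "'y set \<Rightarrow> ('y \<Rightarrow> 'q \<Rightarrow> 'y) \<Rightarrow> 'y \<Rightarrow> 'q \<times> int \<Rightarrow> 'y" where
  "half_act Y act y x = op_pow Y act y (- of_bool (snd x = -1)) (fst x)"

definition signed_cochain ::
  "'q set \<Rightarrow> ('q \<Rightarrow> 'q \<Rightarrow> 'q) \<Rightarrow> 'y set \<Rightarrow> ('y \<Rightarrow> 'q \<Rightarrow> 'y) \<Rightarrow>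
   ('y \<Rightarrow> 'q \<Rightarrow> 'q \<Rightarrow> 'k \<Rightarrow>\<^sub>0 int) \<Rightarrow> 'y \<Rightarrow> 'q \<times> int \<Rightarrow> 'q \<times> int \<Rightarrow> 'k \<Rightarrow>\<^sub>0 int" where
  "signed_cochain Q rop Y act \<psi> y x z =
     frag_cmul (snd x * snd z)
       (\<psi> (half_act Y act (half_act Y act y x) z) (half_act Q rop (fst x) z) (fst z))"

context rack_set
begin

abbreviation "sact \<equiv> signed_act Y act"
abbreviation "srop \<equiv> signed_rop Q rop"

abbreviation signed_defect where
  "signed_defect \<psi> \<equiv> cocycle_defect srop sact (signed_cochain Q rop Y act \<psi>)"


lemma half_act_closed: "y \<in> Y \<Longrightarrow> x \<in> signed_letters Q \<Longrightarrow> half_act Y act y x \<in> Y"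
  by (auto simp: signed_letters_def half_act_def undo_closed)

text \<open>
  A negative letter followed by its positive counterpart contributes nothing: the weight of the negative
  letter at \<open>y\<close> is minus the weight of the positive letter at the region reached from
  \<open>y\<close>. The next lemma is the same for the second strand, which also acts on the first one;
  it needs distributivity, because the region there is displaced by both letters.
\<close>

lemma signed_cochain_invert_first:
  "signed_cochain Q rop Y act \<psi> y (a, -1) z =
    - signed_cochain Q rop Y act \<psi> (sact y (a, -1)) (a, 1) z"
  by (simp add: signed_cochain_def half_act_def signed_act_def)

lemma signed_cochain_invert_second:
  assumes "y \<in> Y" "x \<in> signed_letters Q" "b \<in> Q"
  shows "signed_cochain Q rop Y act \<psi> y x (b, -1) =
    - signed_cochain Q rop Y act \<psi> (sact y (b, -1)) (srop x (b, -1)) (b, 1)"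
  using signed_act_distrib[of y x "(b, -1)"] assms
  by (auto simp: signed_cochain_def half_act_def signed_act_def signed_rop_def signed_letters_def)

lemma srop_Pair:
  "srop (a, -1) z = (signed_act Q rop a z, -1)" "srop (a, 1) z = (signed_act Q rop a z, 1)"
  by (simp_all add: signed_rop_def)

lemma sact_cancel:
  assumes "y \<in> Y" "a \<in> Q"
  shows "sact (sact y (a, -1)) (a, 1) = y"
  using assms by (simp add: signed_act_def undo_act)

lemma srop_cancel:
  assumes "x \<in> signed_letters Q" "a \<in> Q"
  shows "srop (srop x (a, -1)) (a, 1) = x"
proof -
  interpret self: rack_set Q rop Q rop by (rule rack_set_self)
  show ?thesis using assms
    by (auto simp: signed_rop_def signed_act_def signed_letters_def self.undo_act)
qed

lemma signed_lettersI: "a \<in> Q \<Longrightarrow> (a, -1) \<in> signed_letters Q" "a \<in> Q \<Longrightarrow> (a, 1) \<in> signed_letters Q"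
  by (simp_all add: signed_letters_def)

text \<open>
  Inverting a strand reverses the Reidemeister move. In the four terms containing the letter
  itself, the weights change sign and are taken at the region beyond it; the two others, one on
  each side, are exchanged, because \<open>a\<close> leads from the new region back to \<open>y\<close>. For the
  second and third strands the same is true after the colours of the strands before it have also been
  moved across.
\<close>

lemma signed_defect_invert_first:
  assumes "y \<in> Y" "a \<in> Q" "z \<in> signed_letters Q" "w \<in> signed_letters Q"
  shows "signed_defect \<psi> y (a, -1) z w = - signed_defect \<psi> (sact y (a, -1)) (a, 1) z w"
proof -
  let ?C = "signed_cochain Q rop Y act \<psi>" and ?y = "sact y (a, -1)"
  \<comment> \<open>Letters other than \<open>a\<close> carry \<open>a\<^sup>-\<close> to another negative letter, so the inversion rule still applies.\<close>
  have conj: "?C (sact y x) (srop (a, -1) x) t = - ?C (sact ?y x) (srop (a, 1) x) t"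
    if "x \<in> signed_letters Q" for x t
    using signed_cochain_invert_first[of \<psi> "sact y x" "signed_act Q rop a x" t]
      signed_act_distrib[of y "(a, -1)" x] that assms
    by (simp add: srop_Pair signed_lettersI)
  show ?thesis
    unfolding cocycle_defect_def sact_cancel[OF assms(1,2)] conj[OF assms(3)] conj[OF assms(4)]
      signed_cochain_invert_first[of \<psi> y]
    by simp
qed

lemma signed_defect_invert_second:
  assumes "y \<in> Y" "x \<in> signed_letters Q" "b \<in> Q" "w \<in> signed_letters Q"
  shows "signed_defect \<psi> y x (b, -1) w =
    - signed_defect \<psi> (sact y (b, -1)) (srop x (b, -1)) (b, 1) w"
proof -
  interpret signed: rack_set "signed_letters Q" srop Y sact by (rule rack_set_signed)
  interpret self: rack_set "signed_letters Q" srop "signed_letters Q" srop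
    by (rule signed.rack_set_self)
  interpret base: rack_set Q rop Q rop by (rule rack_set_self)
  let ?C = "signed_cochain Q rop Y act \<psi>"
  let ?y = "sact y (b, -1)" and ?x = "srop x (b, -1)"
  have b: "(b, -1) \<in> signed_letters Q" using assms by (simp add: signed_lettersI)
  have yw: "sact y w \<in> Y" "srop x w \<in> signed_letters Q" "signed_act Q rop b w \<in> Q"
    using assms signed.act_closed self.act_closed base.signed_act_closed by auto
  have 1: "?C (sact y x) (b, -1) w = - ?C (sact ?y ?x) (b, 1) w"
    using signed_cochain_invert_first[of \<psi> "sact y x"] signed.act_distrib[of y x "(b, -1)"] assms b
    by simp
  have 2: "?C y x w = ?C (sact ?y (b, 1)) (srop ?x (b, 1)) w"
    using assms by (simp add: sact_cancel srop_cancel)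
  have 3: "?C (sact y w) (srop x w) (srop (b, -1) w) =
      - ?C (sact ?y w) (srop ?x w) (srop (b, 1) w)"
    using signed_cochain_invert_second[OF yw, of \<psi>] signed.act_distrib[of y "(b, -1)" w]
      signed.rack_distrib[of x "(b, -1)" w] assms b
    by (simp add: srop_Pair)
  show ?thesis
    unfolding cocycle_defect_def 1 3 signed_cochain_invert_first[of \<psi> y]
      signed_cochain_invert_second[OF assms(1-3)]
    unfolding 2 by simp
qed

lemma signed_defect_invert_third:
  assumes "y \<in> Y" "x \<in> signed_letters Q" "z \<in> signed_letters Q" "c \<in> Q"
  shows "signed_defect \<psi> y x z (c, -1) =
    - signed_defect \<psi> (sact y (c, -1)) (srop x (c, -1)) (srop z (c, -1)) (c, 1)"
proof -
  interpret signed: rack_set "signed_letters Q" srop Y sact by (rule rack_set_signed)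
  interpret self: rack_set "signed_letters Q" srop "signed_letters Q" srop
    by (rule signed.rack_set_self)
  let ?C = "signed_cochain Q rop Y act \<psi>"
  let ?y = "sact y (c, -1)" and ?x = "srop x (c, -1)" and ?z = "srop z (c, -1)"
  have c: "(c, -1) \<in> signed_letters Q" using assms by (simp add: signed_lettersI)
  have 1: "?C (sact y x) z (c, -1) = - ?C (sact ?y ?x) ?z (c, 1)"
    using signed_cochain_invert_second[of "sact y x" z c \<psi>] signed.act_distrib[of y x "(c, -1)"] assms c
    by (simp add: signed.act_closed)
  have 2: "?C (sact y z) (srop x z) (c, -1) = - ?C (sact ?y ?z) (srop ?x ?z) (c, 1)"
    using signed_cochain_invert_second[of "sact y z" "srop x z" c \<psi>] signed.act_distrib[of y z "(c, -1)"]
      signed.rack_distrib[of x z "(c, -1)"] assms c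
    by (simp add: signed.act_closed self.act_closed)
  have 3: "?C y x z = ?C (sact ?y (c, 1)) (srop ?x (c, 1)) (srop ?z (c, 1))"
    using assms by (simp add: sact_cancel srop_cancel)
  show ?thesis
    unfolding cocycle_defect_def 1 2 signed_cochain_invert_second[OF assms(1,2,4)]
      signed_cochain_invert_second[OF assms(1,3,4)]
    unfolding 3 by simp
qed

text \<open>
  Signs are removed one strand at a time, beginning with the third: for positive letters the signed
  defect is the defect of \<open>\<psi>\<close>.
\<close>

lemma cocycle_mod_signed:
  assumes "difference_closed K" and coc: "cocycle_mod K Q rop Y act \<psi>"
  shows "cocycle_mod K (signed_letters Q) srop Y sact (signed_cochain Q rop Y act \<psi>)"
proof -
  interpret difference_closed K by fact
  interpret signed: rack_set "signed_letters Q" srop Y sact by (rule rack_set_signed)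
  interpret self: rack_set "signed_letters Q" srop "signed_letters Q" srop
    by (rule signed.rack_set_self)
  have 1: "signed_defect \<psi> y (a, 1) (b, 1) (c, 1) \<in> K"
    if "y \<in> Y" "a \<in> Q" "b \<in> Q" "c \<in> Q" for y a b c
    using coc that
    by (simp add: cocycle_mod_def cocycle_defect_def signed_cochain_def half_act_def
        signed_act_def signed_rop_def)
  have 2: "signed_defect \<psi> y x (b, 1) (c, 1) \<in> K"
    if "y \<in> Y" "x \<in> signed_letters Q" "b \<in> Q" "c \<in> Q" for y x b c
    using that(2) unfolding signed_letters_def
    by (auto simp: 1 minus_mem signed_defect_invert_first signed.act_closed signed_lettersI that)
  have 3: "signed_defect \<psi> y x z (c, 1) \<in> K"
    if "y \<in> Y" "x \<in> signed_letters Q" "z \<in> signed_letters Q" "c \<in> Q" for y x z c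
    using that(3) unfolding signed_letters_def
    by (auto simp: 2 minus_mem signed_defect_invert_second signed.act_closed self.act_closed
        signed_lettersI that)
  have "signed_defect \<psi> y x z w \<in> K"
    if "y \<in> Y" "x \<in> signed_letters Q" "z \<in> signed_letters Q" "w \<in> signed_letters Q" for y x z w
    using that(4) unfolding signed_letters_def
    by (auto simp: 3 minus_mem signed_defect_invert_third signed.act_closed self.act_closed
        signed_lettersI that)
  then show ?thesis by (simp add: cocycle_mod_def)
qed

end

section \<open>Tuples as signed words\<close>

definition signed_word :: "(nat \<Rightarrow> int) \<Rightarrow> (nat \<Rightarrow> 'q) \<Rightarrow> nat \<Rightarrow> ('q \<times> int) list" where
  "signed_word e c r = map (\<lambda>p. (c p, e p)) [1..<Suc r]"

lemma word_op_eq_foldl: "word_op X f e c r x = foldl (signed_act X f) x (signed_word e c r)"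
  by (simp add: word_op_def signed_word_def foldl_map signed_act_def del: upt_Suc)

lemma partial_op_eq_half_act:
  "partial_op X f e c p x = half_act X f (foldl (signed_act X f) x (signed_word e c (p - 1))) (c p, e p)"
  by (simp add: partial_op_def half_act_def word_op_eq_foldl)

lemma foldl_signed_rop:
  "foldl (signed_rop Q rop) x w = (foldl (signed_act Q rop) (fst x) w, snd x)"
  by (induction w arbitrary: x) (auto simp: signed_rop_def)

lemma signed_word_mem:
  assumes "\<And>p. p \<in> {1..r} \<Longrightarrow> c p \<in> Q" "\<And>p. p \<in> {1..r} \<Longrightarrow> e p \<in> {-1, 1}"
  shows "signed_word e c r \<in> lists (signed_letters Q)"
  using assms by (fastforce simp: signed_word_def signed_letters_def)

lemma letter_chain_signed_word:
  "letter_chain rop act \<psi> y a (signed_word e c r) =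
     (\<Sum>q\<in>{1..r}. \<psi> (foldl act y (signed_word e c (q - 1)))
        (foldl rop a (signed_word e c (q - 1))) (c q, e q))"
proof (induction r)
  case (Suc r)
  have "signed_word e c (Suc r) = signed_word e c r @ [(c (Suc r), e (Suc r))]"
    by (simp add: signed_word_def)
  then show ?case by (simp add: letter_chain_append Suc)
qed (simp add: signed_word_def)

lemma word_chain_signed_word:
  "word_chain rop act \<psi> y (signed_word e c r) w =
     (\<Sum>p\<in>{1..r}. letter_chain rop act \<psi> (foldl act y (signed_word e c (p - 1))) (c p, e p) w)"
proof (induction r)
  case (Suc r)
  have "signed_word e c (Suc r) = signed_word e c r @ [(c (Suc r), e (Suc r))]"
    by (simp add: signed_word_def)
  then show ?case by (simp add: word_chain_append_left Suc)
qed (simp add: signed_word_def)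

text \<open>
  This reconciles two readings of the region at a crossing: the statement moves \<open>y\<close> past the
  whole or half letter of the first word and then along the second word, whereas \<open>word_chain\<close>
  displaces it by half letters only at the end.
\<close>

lemma (in rack_set) foldl_half_act:
  assumes "y \<in> Y" "x \<in> signed_letters Q" "w \<in> lists (signed_letters Q)"
  shows "foldl sact (half_act Y act y x) w = half_act Y act (foldl sact y w) (foldl srop x w)"
proof (cases "snd x = -1")
  case True
  interpret signed: rack_set "signed_letters Q" srop Y sact by (rule rack_set_signed)
  have "half_act Y act z t = sact z t" if "snd t = -1" for z t
    using that by (simp add: half_act_def signed_act_def)
  then show ?thesis
    using signed.foldl_act_distrib_letter[OF assms] True by (simp add: foldl_signed_rop)
next
  case False
  then show ?thesis by (simp add: half_act_def foldl_signed_rop)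
qed

lemma hom_sum_eq_finprod:
  assumes "comm_group A" and h: "h \<in> hom (free_Abelian_group S) A" and "finite I"
    and "\<And>k. k \<in> I \<Longrightarrow> f k \<in> carrier (free_Abelian_group S)"
  shows "h (sum f I) = (\<Otimes>\<^bsub>A\<^esub>k\<in>I. h (f k))"
proof -
  interpret A: comm_group A by fact
  interpret h: group_hom "free_Abelian_group S" A h
    by (simp add: group_hom_def group_hom_axioms_def h A.group_axioms)
  show ?thesis using assms(3,4)
  proof (induction I rule: finite_induct)
    case empty
    show ?case using h.hom_one by simp
  next
    case (insert k I)
    then have "h (f k + sum f I) = h (f k) \<otimes>\<^bsub>A\<^esub> h (sum f I)"
      using h.hom_mult[of "f k" "sum f I"] sum_closed_free_Abelian_group[of I f S] by simp
    moreover have "(\<lambda>k. h (f k)) \<in> I \<rightarrow> carrier A" "h (f k) \<in> carrier A"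
      using insert.prems h.hom_closed by auto
    ultimately show ?case using insert by simp
  qed
qed

locale tuple_rack = rack_set Q rop Y act
  for Q :: "'q set" and rop :: "'q \<Rightarrow> 'q \<Rightarrow> 'q" (infixl "\<^bold>*" 70)
    and Y :: "'y set" and act :: "'y \<Rightarrow> 'q \<Rightarrow> 'y" (infixl "\<star>" 70) +
  fixes m n :: nat and e :: "nat \<Rightarrow> int" and i :: "nat \<Rightarrow> nat"
  assumes e: "p \<in> {1..m} \<Longrightarrow> e p \<in> {-1, 1}"
    and i: "p \<in> {1..m} \<Longrightarrow> i p \<in> {1..n}"
begin

abbreviation "Qn \<equiv> rack_power n Q"
abbreviation "pop \<equiv> power_op Q rop n m e i"
abbreviation "pact \<equiv> power_act Y act m e i"
abbreviation "L \<equiv> signed_letters Q"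

lemma tuple_component: "a \<in> Qn \<Longrightarrow> k \<in> {1..n} \<Longrightarrow> a k \<in> Q"
  unfolding rack_power_def by (rule PiE_mem)

lemma tuple_letter:
  assumes "a \<in> Qn" "p \<in> {1..m}"
  shows "a (i p) \<in> Q" "(a (i p), e p) \<in> L"
  using tuple_component[OF assms(1) i[OF assms(2)]] e[OF assms(2)]
  by (simp_all add: signed_letters_def)

lemma tuple_prefix_mem:
  assumes "a \<in> Qn" "r \<le> m"
  shows "signed_word e (\<lambda>p. a (i p)) r \<in> lists L"
proof (rule signed_word_mem)
  fix p assume "p \<in> {1..r}"
  then have p: "p \<in> {1..m}" using assms(2) by simp
  show "a (i p) \<in> Q" by (rule tuple_letter(1)[OF assms(1) p])
  show "e p \<in> {-1, 1}" by (rule e[OF p])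
qed

definition tuple_word :: "(nat \<Rightarrow> 'q) \<Rightarrow> ('q \<times> int) list" where
  "tuple_word a = signed_word e (\<lambda>p. a (i p)) m"

lemma tuple_word_mem: "a \<in> Qn \<Longrightarrow> tuple_word a \<in> lists L"
  unfolding tuple_word_def by (rule tuple_prefix_mem) auto

lemma power_act_eq: "pact y a = foldl sact y (tuple_word a)"
  by (simp add: power_act_def word_op_eq_foldl tuple_word_def)

lemma power_op_eq: "pop a b = (\<lambda>k\<in>{1..n}. foldl (signed_act Q rop) (a k) (tuple_word b))"
  by (simp add: power_op_def word_op_eq_foldl tuple_word_def)

text \<open>
  This identity makes the map from tuples to words compatible with the operations, so that
  distributivity and the cocycle condition for tuples are instances of those for words.
\<close>

lemma tuple_word_power_op: "tuple_word (pop a b) = word_rop srop (tuple_word a) (tuple_word b)"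
proof -
  have "pop a b (i p) = foldl (signed_act Q rop) (a (i p)) (tuple_word b)" if "p \<in> {1..m}" for p
    using i[OF that] by (simp add: power_op_eq)
  then show ?thesis
    unfolding tuple_word_def[of a] tuple_word_def[of "pop a b"]
    by (simp add: signed_word_def word_rop_def foldl_signed_rop del: upt_Suc)
qed

sublocale self: rack_set Q rop Q rop by (rule rack_set_self)
sublocale signed: rack_set L srop Y sact by (rule rack_set_signed)
sublocale signed_self: rack_set L srop Q "signed_act Q rop" by (rule self.rack_set_signed)

lemma tuples_rack: "rack Qn pop"
proof
  show "Qn \<noteq> {}" using rack_nonempty by (auto simp: rack_power_def PiE_eq_empty_iff)
next
  fix b assume "b \<in> Qn"
  let ?f = "\<lambda>x. foldl (signed_act Q rop) x (tuple_word b)"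
  let ?g = "inv_into Q ?f"
  have bij: "bij_betw ?f Q Q" using \<open>b \<in> Qn\<close> by (intro signed_self.foldl_act_bij tuple_word_mem)
  note in_f = bij_betwE[OF bij] and in_g = bij_betwE[OF bij_betw_inv_into[OF bij]]
  have pop: "pop a b = restrict (\<lambda>k. ?f (a k)) {1..n}" for a by (rule power_op_eq)
  show "bij_betw (\<lambda>x. pop x b) Qn Qn"
  proof (rule bij_betw_byWitness[where f' = "\<lambda>a. restrict (\<lambda>k. ?g (a k)) {1..n}"])
    show "\<forall>a\<in>Qn. restrict (\<lambda>k. ?g (pop a b k)) {1..n} = a"
    proof
      fix a assume "a \<in> Qn"
      then have "?g (pop a b k) = a k" if "k \<in> {1..n}" for k
        using that bij_betw_inv_into_left[OF bij tuple_component, of a k]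
        unfolding pop by simp
      then show "restrict (\<lambda>k. ?g (pop a b k)) {1..n} = a"
        using \<open>a \<in> Qn\<close> unfolding rack_power_def by (intro PiE_ext[OF restrict_PiE_iff[THEN iffD2]]) auto
    qed
    show "\<forall>a\<in>Qn. pop (restrict (\<lambda>k. ?g (a k)) {1..n}) b = a"
    proof
      fix a assume "a \<in> Qn"
      then have "?f (?g (a k)) = a k" if "k \<in> {1..n}" for k
        using that bij_betw_inv_into_right[OF bij tuple_component, of a k] by simp
      then show "pop (restrict (\<lambda>k. ?g (a k)) {1..n}) b = a"
        unfolding pop using \<open>a \<in> Qn\<close> unfolding rack_power_def
        by (intro PiE_ext[OF restrict_PiE_iff[THEN iffD2]]) auto
    qed
    show "(\<lambda>a. pop a b) ` Qn \<subseteq> Qn"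
      using in_f tuple_component unfolding pop by (auto simp: rack_power_def)
    show "(\<lambda>a. restrict (\<lambda>k. ?g (a k)) {1..n}) ` Qn \<subseteq> Qn"
      using in_g tuple_component by (auto simp: rack_power_def)
  qed
next
  fix a b c assume abc: "a \<in> Qn" "b \<in> Qn" "c \<in> Qn"
  have "foldl (signed_act Q rop) (pop a b k) (tuple_word c) =
      foldl (signed_act Q rop) (pop a c k) (tuple_word (pop b c))" if "k \<in> {1..n}" for k
  proof -
    have "a k \<in> Q" using abc that by (intro tuple_component)
    then show ?thesis
      using signed_self.foldl_act_distrib[OF _ tuple_word_mem tuple_word_mem, of "a k" b c] abc that
      by (simp add: power_op_eq[of a] tuple_word_power_op)
  qed
  then show "pop (pop a b) c = pop (pop a c) (pop b c)"
    unfolding power_op_eq[of "pop a b" c] power_op_eq[of "pop a c" "pop b c"]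
    by (rule restrict_ext)
qed

lemma tuples_rack_set: "rack_set Qn pop Y pact"
proof -
  interpret rack Qn pop by (rule tuples_rack)
  show ?thesis
  proof
    show "Y \<noteq> {}" by (rule set_nonempty)
    show "bij_betw (\<lambda>y. pact y a) Y Y" if "a \<in> Qn" for a
      unfolding power_act_eq using that by (intro signed.foldl_act_bij tuple_word_mem)
    show "pact (pact y a) b = pact (pact y b) (pop a b)" if "y \<in> Y" "a \<in> Qn" "b \<in> Qn" for y a b
      unfolding power_act_eq tuple_word_power_op
      using that by (intro signed.foldl_act_distrib tuple_word_mem)
  qed
qed

definition induced_chain :: "'y \<Rightarrow> (nat \<Rightarrow> 'q) \<Rightarrow> (nat \<Rightarrow> 'q) \<Rightarrow> 'y \<times> 'q \<times> 'q \<Rightarrow>\<^sub>0 int" where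
  "induced_chain y a b =
     word_chain srop sact (signed_cochain Q rop Y act (\<lambda>y a b. frag_of (y, a, b)))
       y (tuple_word a) (tuple_word b)"

lemma induced_chain_eq_sum:
  assumes y: "y \<in> Y" and a: "a \<in> Qn" and b: "b \<in> Qn"
  shows "induced_chain y a b =
    (\<Sum>p\<in>{1..m}. \<Sum>q\<in>{1..m}. frag_cmul (e p * e q) (frag_of
       (partial_op Y act e (\<lambda>r. b (i r)) q (partial_op Y act e (\<lambda>r. a (i r)) p y),
        partial_op Q rop e (\<lambda>r. b (i r)) q (a (i p)),
        b (i q))))"
proof -
  have w: "signed_word e (\<lambda>r. c (i r)) (p - 1) \<in> lists L" if "c \<in> Qn" "p \<in> {1..m}" for c p
    by (rule tuple_prefix_mem) (use that in auto)
  have "foldl sact (half_act Y act (foldl sact y (signed_word e (\<lambda>r. a (i r)) (p - 1))) (a (i p), e p))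
          (signed_word e (\<lambda>r. b (i r)) (q - 1)) =
        half_act Y act (foldl sact (foldl sact y (signed_word e (\<lambda>r. a (i r)) (p - 1)))
          (signed_word e (\<lambda>r. b (i r)) (q - 1)))
          (foldl srop (a (i p), e p) (signed_word e (\<lambda>r. b (i r)) (q - 1)))"
    if "p \<in> {1..m}" "q \<in> {1..m}" for p q
    using that w a b tuple_letter y by (intro foldl_half_act signed.foldl_act_closed) auto
  then show ?thesis
    unfolding induced_chain_def tuple_word_def word_chain_signed_word letter_chain_signed_word
    by (intro sum.cong refl)
      (simp add: signed_cochain_def partial_op_eq_half_act foldl_signed_rop)
qed

lemma induced_generator_mem:
  assumes y: "y \<in> Y" and a: "a \<in> Qn" and b: "b \<in> Qn" and p: "p \<in> {1..m}" and q: "q \<in> {1..m}"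
  shows "(partial_op Y act e (\<lambda>r. b (i r)) q (partial_op Y act e (\<lambda>r. a (i r)) p y),
        partial_op Q rop e (\<lambda>r. b (i r)) q (a (i p)), b (i q)) \<in> Y \<times> Q \<times> Q"
proof -
  have w: "signed_word e (\<lambda>r. c (i r)) (p - 1) \<in> lists L" if "c \<in> Qn" "p \<in> {1..m}" for c p
    by (rule tuple_prefix_mem) (use that in auto)
  show ?thesis
    unfolding partial_op_eq_half_act using assms w tuple_letter
    by (auto intro!: half_act_closed self.half_act_closed signed.foldl_act_closed
        signed_self.foldl_act_closed simp del: in_lists_conv_set)
qed

lemma induced_chain_mem:
  assumes "y \<in> Y" "a \<in> Qn" "b \<in> Qn"
  shows "induced_chain y a b \<in> carrier (rack_2_chains Q Y)"
  unfolding induced_chain_eq_sum[OF assms] rack_2_chains_def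
  by (intro sum_closed_free_Abelian_group)
    (use induced_generator_mem[OF assms] keys_cmul in fastforce)

text \<open>
  The double product is the image of the double sum in \<open>induced_chain_eq_sum\<close>, since
  \<open>\<theta>\<close> turns sums into products and integer multiples into powers.
\<close>

lemma induced_value_eq:
  assumes A: "comm_group A" and h: "\<theta> \<in> hom (rack_2_chains Q Y) A"
    and y: "y \<in> Y" and a: "a \<in> Qn" and b: "b \<in> Qn"
  shows "induced_value Q rop Y act A \<theta> m e i y a b = \<theta> (induced_chain y a b)"
proof -
  interpret A: comm_group A by fact
  note h' = h[unfolded rack_2_chains_def]
  interpret h: group_hom "free_Abelian_group (Y \<times> Q \<times> Q)" A \<theta>
    by (simp add: group_hom_def group_hom_axioms_def h' A.group_axioms)
  define t where "t p q = (partial_op Y act e (\<lambda>r. b (i r)) q (partial_op Y act e (\<lambda>r. a (i r)) p y),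
        partial_op Q rop e (\<lambda>r. b (i r)) q (a (i p)), b (i q))" for p q
  have t: "t p q \<in> Y \<times> Q \<times> Q" if "p \<in> {1..m}" "q \<in> {1..m}" for p q
    using induced_generator_mem[OF y a b that] by (simp add: t_def)
  let ?f = "\<lambda>p q. frag_cmul (e p * e q) (frag_of (t p q))"
  have f: "?f p q \<in> carrier (free_Abelian_group (Y \<times> Q \<times> Q))" if "p \<in> {1..m}" "q \<in> {1..m}" for p q
    using t[OF that] keys_cmul[of "e p * e q" "frag_of (t p q)"] by auto
  have pow: "\<theta> (?f p q) = \<theta> (frag_of (t p q)) [^]\<^bsub>A\<^esub> (e p * e q)"
    if "p \<in> {1..m}" "q \<in> {1..m}" for p q
    using h.hom_int_pow[of "frag_of (t p q)" "e p * e q"] t[OF that] by simp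
  have "\<theta> (induced_chain y a b) = \<theta> (\<Sum>p\<in>{1..m}. \<Sum>q\<in>{1..m}. ?f p q)"
    by (simp add: induced_chain_eq_sum[OF y a b] t_def)
  also have "\<dots> = (\<Otimes>\<^bsub>A\<^esub>p\<in>{1..m}. \<theta> (\<Sum>q\<in>{1..m}. ?f p q))"
    by (intro hom_sum_eq_finprod[OF A h'] sum_closed_free_Abelian_group f finite_atLeastAtMost)
  also have "\<dots> = (\<Otimes>\<^bsub>A\<^esub>p\<in>{1..m}. \<Otimes>\<^bsub>A\<^esub>q\<in>{1..m}. \<theta> (frag_of (t p q)) [^]\<^bsub>A\<^esub> (e p * e q))"
  proof (rule A.finprod_cong')
    fix p assume p: "p \<in> {1..m}"
    have "\<theta> (\<Sum>q\<in>{1..m}. ?f p q) = (\<Otimes>\<^bsub>A\<^esub>q\<in>{1..m}. \<theta> (?f p q))"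
      by (intro hom_sum_eq_finprod[OF A h'] f p finite_atLeastAtMost)
    also have "\<dots> = (\<Otimes>\<^bsub>A\<^esub>q\<in>{1..m}. \<theta> (frag_of (t p q)) [^]\<^bsub>A\<^esub> (e p * e q))"
      by (rule A.finprod_cong') (use p t pow in auto)
    finally show "\<theta> (\<Sum>q\<in>{1..m}. ?f p q) = \<dots>" .
  qed (use t in \<open>auto intro!: A.finprod_closed\<close>)
  finally show ?thesis by (simp add: induced_value_def t_def)
qed

lemma cocycle_mod_tuples:
  assumes K: "difference_closed K" and coc: "cocycle_mod K Q rop Y act (\<lambda>y a b. frag_of (y, a, b))"
  shows "cocycle_mod K Qn pop Y pact induced_chain"
proof -
  let ?C = "signed_cochain Q rop Y act (\<lambda>y a b. frag_of (y, a, b))"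
  have "cocycle_mod K (lists L) (word_rop srop) Y (foldl sact) (word_chain srop sact ?C)"
    by (rule signed.cocycle_mod_words[OF K cocycle_mod_signed[OF K coc]])
  moreover have "cocycle_defect pop pact induced_chain y a b c =
      cocycle_defect (word_rop srop) (foldl sact) (word_chain srop sact ?C)
        y (tuple_word a) (tuple_word b) (tuple_word c)" for y a b c
    by (simp add: cocycle_defect_def induced_chain_def power_act_eq tuple_word_power_op)
  ultimately show ?thesis
    by (simp add: cocycle_mod_def tuple_word_mem del: in_lists_conv_set)
qed

end

section \<open>Induced cocycles\<close>

lemma difference_closed_kernel:
  assumes "group A" and h: "h \<in> hom (free_Abelian_group S) A"
  shows "difference_closed {x. Poly_Mapping.keys x \<subseteq> S \<and> h x = \<one>\<^bsub>A\<^esub>}"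
proof -
  interpret A: group A by fact
  interpret h: group_hom "free_Abelian_group S" A h
    by (simp add: group_hom_def group_hom_axioms_def h A.group_axioms)
  show ?thesis
  proof
    show "0 \<in> {x. Poly_Mapping.keys x \<subseteq> S \<and> h x = \<one>\<^bsub>A\<^esub>}" using h.hom_one by simp
  next
    fix u v assume "u \<in> {x. Poly_Mapping.keys x \<subseteq> S \<and> h x = \<one>\<^bsub>A\<^esub>}"
      and "v \<in> {x. Poly_Mapping.keys x \<subseteq> S \<and> h x = \<one>\<^bsub>A\<^esub>}"
    then show "u - v \<in> {x. Poly_Mapping.keys x \<subseteq> S \<and> h x = \<one>\<^bsub>A\<^esub>}"
      using h.hom_mult[of u "- v"] h.hom_inv[of v] keys_diff[of u v] by auto
  qed
qed

lemma hom_eq_iff_diff_kernel: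
  assumes "group A" and h: "h \<in> hom (free_Abelian_group S) A"
    and u: "Poly_Mapping.keys u \<subseteq> S" and v: "Poly_Mapping.keys v \<subseteq> S"
  shows "h u = h v \<longleftrightarrow> u - v \<in> {x. Poly_Mapping.keys x \<subseteq> S \<and> h x = \<one>\<^bsub>A\<^esub>}"
proof -
  interpret A: group A by fact
  interpret h: group_hom "free_Abelian_group S" A h
    by (simp add: group_hom_def group_hom_axioms_def h A.group_axioms)
  have d: "Poly_Mapping.keys (u - v) \<subseteq> S" using keys_diff[of u v] u v by auto
  have c: "h (u - v) \<in> carrier A" "h v \<in> carrier A"
    using h.hom_closed[of "u - v"] h.hom_closed[of v] d v by auto
  have "h u = h (u - v) \<otimes>\<^bsub>A\<^esub> h v"
    using h.hom_mult[of "u - v" v] d v by simp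
  then show ?thesis using d c by (auto simp: A.l_cancel_one)
qed

lemma keys_add3:
  assumes "Poly_Mapping.keys u \<subseteq> S" "Poly_Mapping.keys v \<subseteq> S" "Poly_Mapping.keys w \<subseteq> S"
  shows "Poly_Mapping.keys (u + v + w) \<subseteq> S"
  using assms keys_add[of u v] keys_add[of "u + v" w] by blast

lemma hom_add3:
  assumes "h \<in> hom (free_Abelian_group S) A"
    and "Poly_Mapping.keys u \<subseteq> S" "Poly_Mapping.keys v \<subseteq> S" "Poly_Mapping.keys w \<subseteq> S"
  shows "h (u + v + w) = h u \<otimes>\<^bsub>A\<^esub> h v \<otimes>\<^bsub>A\<^esub> h w"
  using hom_mult[OF assms(1), of u v] hom_mult[OF assms(1), of "u + v" w] assms keys_add[of u v]
  by (auto simp: subset_iff)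

theorem proposition5p2:
  fixes Q :: "'q set" and rop :: "'q \<Rightarrow> 'q \<Rightarrow> 'q"
    and Y :: "'y set" and act :: "'y \<Rightarrow> 'q \<Rightarrow> 'y"
    and A :: "('a, 'z) monoid_scheme"
    and \<theta> :: "('y \<times> 'q \<times> 'q \<Rightarrow>\<^sub>0 int) \<Rightarrow> 'a"
    and m n :: nat and e :: "nat \<Rightarrow> int" and i :: "nat \<Rightarrow> nat"
  assumes "rack Q rop"
    and "rack_set Q rop Y act"
    and "comm_group A"
    and "shadow_rack_2_cocycle Q rop Y act A \<theta>"
    and "0 < m" and "0 < n"
    and "\<forall>p\<in>{1..m}. e p \<in> {-1, 1}"
    and "\<forall>p\<in>{1..m}. i p \<in> {1..n}"
  shows
    "rack (rack_power n Q) (power_op Q rop n m e i) \<and>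
     rack_set (rack_power n Q) (power_op Q rop n m e i) Y (power_act Y act m e i) \<and>
     (\<exists>\<theta>'\<in>hom (rack_2_chains (rack_power n Q) Y) A.
        \<forall>y\<in>Y. \<forall>a\<in>rack_power n Q. \<forall>b\<in>rack_power n Q.
          \<theta>' (frag_of (y, a, b)) = induced_value Q rop Y act A \<theta> m e i y a b) \<and>
     (\<forall>\<theta>'\<in>hom (rack_2_chains (rack_power n Q) Y) A.
        (\<forall>y\<in>Y. \<forall>a\<in>rack_power n Q. \<forall>b\<in>rack_power n Q.
          \<theta>' (frag_of (y, a, b)) = induced_value Q rop Y act A \<theta> m e i y a b) \<longrightarrow>
        shadow_rack_2_cocycle (rack_power n Q) (power_op Q rop n m e i)
          Y (power_act Y act m e i) A \<theta>')"
proof -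
  interpret tuple_rack Q rop Y act m n e i
    using assms(2,7,8) by (simp add: tuple_rack_def tuple_rack_axioms_def)
  interpret T: rack_set Qn pop Y pact by (rule tuples_rack_set)
  interpret T_self: rack_set Qn pop Qn pop by (rule T.rack_set_self)
  interpret A: comm_group A by (rule assms(3))
  have th: "\<theta> \<in> hom (free_Abelian_group (Y \<times> Q \<times> Q)) A" "\<theta> \<in> hom (rack_2_chains Q Y) A"
    using assms(4) by (simp_all add: shadow_rack_2_cocycle_def rack_2_chains_def)
  define K where "K = {x. Poly_Mapping.keys x \<subseteq> Y \<times> Q \<times> Q \<and> \<theta> x = \<one>\<^bsub>A\<^esub>}"
  have K: "difference_closed K"
    unfolding K_def by (rule difference_closed_kernel[OF A.group_axioms th(1)])
  note K_iff = hom_eq_iff_diff_kernel[OF A.group_axioms th(1), folded K_def]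
  have "cocycle_mod K Q rop Y act (\<lambda>y a b. frag_of (y, a, b))"
    unfolding cocycle_mod_def
  proof (intro ballI)
    fix y a b c assume *: "y \<in> Y" "a \<in> Q" "b \<in> Q" "c \<in> Q"
    then have "\<theta> (frag_of (act y a, b, c) + frag_of (y, a, c) + frag_of (act y c, rop a c, rop b c)) =
        \<theta> (frag_of (y, b, c) + frag_of (act y b, rop a b, c) + frag_of (y, a, b))"
      using assms(4) by (simp add: shadow_rack_2_cocycle_def)
    then show "cocycle_defect rop act (\<lambda>y a b. frag_of (y, a, b)) y a b c \<in> K"
      unfolding cocycle_defect_def using *
      by (subst (asm) K_iff) (simp_all add: keys_add3 act_closed self.act_closed)
  qed
  then have coc: "cocycle_mod K Qn pop Y pact induced_chain" by (rule cocycle_mod_tuples[OF K])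
  have ic: "Poly_Mapping.keys (induced_chain y a b) \<subseteq> Y \<times> Q \<times> Q"
    if "y \<in> Y" "a \<in> Qn" "b \<in> Qn" for y a b
    using induced_chain_mem[OF that] by (simp add: rack_2_chains_def)
  have val: "induced_value Q rop Y act A \<theta> m e i y a b = \<theta> (induced_chain y a b)"
    if "y \<in> Y" "a \<in> Qn" "b \<in> Qn" for y a b
    using induced_value_eq[OF assms(3) th(2) that] .
  have "(\<lambda>(y, a, b). \<theta> (induced_chain y a b)) ` (Y \<times> Qn \<times> Qn) \<subseteq> carrier A"
    using ic hom_in_carrier[OF th(1)] by auto
  then obtain h where "h \<in> hom (free_Abelian_group (Y \<times> Qn \<times> Qn)) A"
    "\<And>x. x \<in> Y \<times> Qn \<times> Qn \<Longrightarrow> h (frag_of x) = (\<lambda>(y, a, b). \<theta> (induced_chain y a b)) x"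
    using A.free_Abelian_group_universal by blast
  then have ex: "\<exists>\<theta>'\<in>hom (rack_2_chains Qn Y) A. \<forall>y\<in>Y. \<forall>a\<in>Qn. \<forall>b\<in>Qn.
      \<theta>' (frag_of (y, a, b)) = induced_value Q rop Y act A \<theta> m e i y a b"
    by (intro bexI[of _ h]) (auto simp: rack_2_chains_def val)
  have "shadow_rack_2_cocycle Qn pop Y pact A \<theta>'"
    if h: "\<theta>' \<in> hom (rack_2_chains Qn Y) A"
      and v: "\<forall>y\<in>Y. \<forall>a\<in>Qn. \<forall>b\<in>Qn.
        \<theta>' (frag_of (y, a, b)) = induced_value Q rop Y act A \<theta> m e i y a b" for \<theta>'
    unfolding shadow_rack_2_cocycle_def
  proof (intro conjI ballI)
    show "\<theta>' \<in> hom (rack_2_chains Qn Y) A" by (rule h)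
    note h' = h[unfolded rack_2_chains_def]
    fix y a b c assume *: "y \<in> Y" "a \<in> Qn" "b \<in> Qn" "c \<in> Qn"
    \<comment> \<open>By its values on generators, \<open>\<theta>'\<close> is \<open>\<theta>\<close> applied to induced chains.\<close>
    have lift: "\<theta>' (frag_of (y1, a1, b1) + frag_of (y2, a2, b2) + frag_of (y3, a3, b3)) =
        \<theta> (induced_chain y1 a1 b1 + induced_chain y2 a2 b2 + induced_chain y3 a3 b3)"
      if "y1 \<in> Y" "y2 \<in> Y" "y3 \<in> Y" "a1 \<in> Qn" "a2 \<in> Qn" "a3 \<in> Qn"
        "b1 \<in> Qn" "b2 \<in> Qn" "b3 \<in> Qn" for y1 y2 y3 a1 a2 a3 b1 b2 b3
      using that v ic by (simp add: hom_add3[OF h'] hom_add3[OF th(1)] val)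
    have "cocycle_defect pop pact induced_chain y a b c \<in> K"
      using coc * by (simp add: cocycle_mod_def)
    then have "\<theta> (induced_chain (pact y a) b c + induced_chain y a c
          + induced_chain (pact y c) (pop a c) (pop b c)) =
        \<theta> (induced_chain y b c + induced_chain (pact y b) (pop a b) c + induced_chain y a b)"
      unfolding cocycle_defect_def using *
      by (subst K_iff) (simp_all add: keys_add3 ic T.act_closed T_self.act_closed)
    then show "\<theta>' (frag_of (pact y a, b, c) + frag_of (y, a, c) + frag_of (pact y c, pop a c, pop b c)) =
        \<theta>' (frag_of (y, b, c) + frag_of (pact y b, pop a b, c) + frag_of (y, a, b))"
      using * by (simp add: lift T.act_closed T_self.act_closed)
  qed
  then show ?thesis using tuples_rack tuples_rack_set ex by blast
qed

end
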